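(* For every $s\in(0,2)$, the metric $|z|^{-s}|dz|^2$ (in the coordinate $z$ of $\mathbb C$) is a fundamental metric on $\mathbb C\setminus\{0\}$; that is, there exists a family $(E_q)_{q\in\mathbb C\setminus\{0\}}$ of Evans-Selberg potentials on $\mathbb C\setminus\{0\}$, with $E_q$ having pole $q$, whose associated fundamental metric is $|z|^{-s}|dz|^2$.
   Context: Let $\Sigma$ be an open Riemann surface and $q\in\Sigma$. An Evans-Selberg potential on $\Sigma$ with pole $q$ is a real-valued function $E_q(p)$ such that: (i) $E_q(p)$ is harmonic in $p$ on $\Sigma\setminus\{q\}$; (ii) $E_q(p)-\log|\varphi(p)-\varphi(q)|$ is bounded near $q$, where $\varphi$ is a local coordinate; (iii) $E_q(p)\to+\infty$ as $p\to a_\infty$, the Alexandroff ideal boundary point of $\Sigma$ (i.e. the point at infinity of the one-point compactification of $\Sigma$). An open Riemann surface is potentially-theoretically parabolic if it carries no Green function, equivalently no non-constant subharmonic function bounded from above; $\mathbb C\setminus\{0\}$ is such a surface. On a potential-theoretically parabolic Riemann surface $\Sigma$, given Evans-Selberg potentials $E_q$ with pole $q$ for $q\in\Sigma$, the (associated) fundamental metric in the local coordinate $z=\varphi(p)$ is $$c(z)|dz|^2:=\exp\Big(\lim_{q\to p}\big(E_q(p)-\log|\varphi(p)-\varphi(q)|\big)\Big)|dz|^2 .$$ On $\mathbb C\setminus\{0\}$ the coordinate $\varphi$ is the identity. *)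

theory Defs
  imports "HOL-Analysis.Analysis"
begin

text \<open>
  The surfaces considered are planar domains (connected open subsets of the complex plane),
  with the identity as global coordinate.
\<close>

text \<open>
  Harmonicity on an open set: \<open>u\<close> is of class $C^2$ and its Laplacian vanishes.  The
  functions \<open>ux\<close>, \<open>uy\<close>, \<open>uxx\<close>, ... are the partial derivatives in the real and imaginary
  directions.
\<close>

definition harmonic_on :: "(complex \<Rightarrow> real) \<Rightarrow> complex set \<Rightarrow> bool"
  where "harmonic_on u U \<longleftrightarrow> open U \<and>
    (\<exists>ux uy uxx uxy uyx uyy :: complex \<Rightarrow> real.
       (\<forall>z\<in>U. (u has_derivative (\<lambda>h. ux z * Re h + uy z * Im h)) (at z) \<and>
              (ux has_derivative (\<lambda>h. uxx z * Re h + uxy z * Im h)) (at z) \<and>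
              (uy has_derivative (\<lambda>h. uyx z * Re h + uyy z * Im h)) (at z) \<and>
              uxx z + uyy z = 0) \<and>
       continuous_on U uxx \<and> continuous_on U uxy \<and> continuous_on U uyx \<and> continuous_on U uyy)"

text \<open>
  Convergence to the ideal boundary point of \<open>S\<close>, which is the point \<open>None\<close> of the
  Alexandroff compactification; \<open>the\<close> only strips the constructor \<open>Some\<close> from the points
  of \<open>S\<close>.
\<close>

definition at_ideal_boundary :: "complex set \<Rightarrow> complex filter"
  where "at_ideal_boundary S =
    filtermap the (atin (Alexandroff_compactification (top_of_set S)) None)"

text \<open>The value \<open>E q\<close> of a potential \<open>E\<close> at its pole \<open>q\<close> is irrelevant.\<close>

definition Evans_Selberg_potential :: "complex set \<Rightarrow> complex \<Rightarrow> (complex \<Rightarrow> real) \<Rightarrow> bool"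
  where "Evans_Selberg_potential S q E \<longleftrightarrow>
    open S \<and> connected S \<and> q \<in> S \<and>
    harmonic_on E (S - {q}) \<and>
    Bfun (\<lambda>p. E p - ln (cmod (p - q))) (at q) \<and>
    filterlim E at_top (at_ideal_boundary S)"

text \<open>
  A conformal metric $c(z)|dz|^2$ is represented by its density \<open>c\<close>, and \<open>E q p\<close> is the value
  at \<open>p\<close> of the potential with pole \<open>q\<close>.  In the limit the point \<open>p\<close> is fixed and the pole
  moves; the limit is required to exist.  Parabolicity of \<open>S\<close> need not be demanded separately:
  a surface that carries an Evans-Selberg potential is parabolic.
\<close>

definition associated_fundamental_metric ::
    "complex set \<Rightarrow> (complex \<Rightarrow> complex \<Rightarrow> real) \<Rightarrow> (complex \<Rightarrow> real) \<Rightarrow> bool"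
  where "associated_fundamental_metric S E c \<longleftrightarrow>
    (\<forall>p\<in>S. \<exists>L. ((\<lambda>q. E q p - ln (cmod (p - q))) \<longlongrightarrow> L) (at p within S) \<and> c p = exp L)"

definition fundamental_metric :: "complex set \<Rightarrow> (complex \<Rightarrow> real) \<Rightarrow> bool"
  where "fundamental_metric S c \<longleftrightarrow>
    (\<exists>E. (\<forall>q\<in>S. Evans_Selberg_potential S q (E q)) \<and> associated_fundamental_metric S E c)"

end

theory Submission
  imports Defs
begin

text \<open>
  Put \<open>t = s / 2\<close>, so that \<open>0 < t < 1\<close>, and take
  $$E_q(p) = \log|p - q| - t \log|p| - t \log|q|.$$
  As a combination of functions $\log|p - a|$ and a constant it is harmonic in \<open>p\<close> away from
  \<open>0\<close> and \<open>q\<close> (\<open>harmonic_on_ln_cmod\<close>), and \<open>E\<^sub>q(p) - log|p - q|\<close> is continuous at \<open>q\<close>.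
  The ideal boundary of the punctured plane has only the two ends \<open>0\<close> and \<open>\<infinity>\<close>
  (\<open>at_ideal_boundary_punctured_plane_le\<close>).  At \<open>0\<close> the term $-t\log|p|$ tends to $+\infty$
  because \<open>t > 0\<close>, while $\log|p-q|$ stays bounded; at \<open>\<infinity>\<close> the potential grows like
  $(1-t)\log|p|$, and \<open>t < 1\<close>.  So each \<open>E\<^sub>q\<close> is an Evans-Selberg potential
  (\<open>Evans_Selberg_potential_punctured_plane\<close>).  The term $-t\log|q|$, which is constant in
  \<open>p\<close>, makes $E_q(p) - \log|p-q|$ tend to $-2t\log|p| = -s\log|p|$ as \<open>q\<close> tends to \<open>p\<close>, and
  exponentiating gives the density $|p|^{-s}$.
\<close>

section \<open>Harmonic functions\<close>

lemma has_derivative_ln_cmod: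
  assumes "z \<noteq> a"
  shows "((\<lambda>w. ln (cmod (w - a))) has_derivative
    (\<lambda>h. Re (z - a) / (cmod (z - a))\<^sup>2 * Re h + Im (z - a) / (cmod (z - a))\<^sup>2 * Im h)) (at z)"
proof -
  have cmod: "((\<lambda>w. cmod (w - a)) has_derivative (\<lambda>h. inner h (sgn (z - a)))) (at z)"
    by (rule has_derivative_eq_rhs[OF has_derivative_compose[OF _ has_derivative_norm]])
       (use assms in \<open>auto intro!: derivative_eq_intros\<close>)
  have "((\<lambda>w. ln (cmod (w - a))) has_derivative
      (\<lambda>h. inner h (sgn (z - a)) * inverse (cmod (z - a)))) (at z)"
    by (rule has_derivative_ln[OF _ cmod]) (use assms in simp)
  then show ?thesis
    by (rule has_derivative_eq_rhs)
       (use assms in \<open>auto simp: fun_eq_iff inner_complex_def sgn_div_norm divide_simps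
          power2_eq_square algebra_simps\<close>)
qed

lemma has_derivative_Re_div_cmod_squared:
  assumes "z \<noteq> a"
  shows "((\<lambda>w. Re (w - a) / (cmod (w - a))\<^sup>2) has_derivative
    (\<lambda>h. ((Im (z - a))\<^sup>2 - (Re (z - a))\<^sup>2) / (cmod (z - a)) ^ 4 * Re h
       + (- 2 * Re (z - a) * Im (z - a)) / (cmod (z - a)) ^ 4 * Im h)) (at z)"
proof -
  have D: "(Re z - Re a)\<^sup>2 + (Im z - Im a)\<^sup>2 \<noteq> 0"
    using assms by (simp add: complex_eq_iff sum_power2_eq_zero_iff)
  have pow4: "(cmod w) ^ 4 = ((Re w)\<^sup>2 + (Im w)\<^sup>2)\<^sup>2" for w
    by (simp flip: cmod_power2)
  show ?thesis
    unfolding pow4 cmod_power2 using D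
    by (auto intro!: derivative_eq_intros simp: fun_eq_iff divide_simps)
       (simp_all add: algebra_simps power2_eq_square)
qed

lemma has_derivative_Im_div_cmod_squared:
  assumes "z \<noteq> a"
  shows "((\<lambda>w. Im (w - a) / (cmod (w - a))\<^sup>2) has_derivative
    (\<lambda>h. (- 2 * Re (z - a) * Im (z - a)) / (cmod (z - a)) ^ 4 * Re h
       + ((Re (z - a))\<^sup>2 - (Im (z - a))\<^sup>2) / (cmod (z - a)) ^ 4 * Im h)) (at z)"
proof -
  have D: "(Re z - Re a)\<^sup>2 + (Im z - Im a)\<^sup>2 \<noteq> 0"
    using assms by (simp add: complex_eq_iff sum_power2_eq_zero_iff)
  have pow4: "(cmod w) ^ 4 = ((Re w)\<^sup>2 + (Im w)\<^sup>2)\<^sup>2" for w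
    by (simp flip: cmod_power2)
  show ?thesis
    unfolding pow4 cmod_power2 using D
    by (auto intro!: derivative_eq_intros simp: fun_eq_iff divide_simps)
       (simp_all add: algebra_simps power2_eq_square)
qed

lemma harmonic_onI:
  assumes "open U"
    and "\<And>z. z \<in> U \<Longrightarrow> (u has_derivative (\<lambda>h. ux z * Re h + uy z * Im h)) (at z)"
    and "\<And>z. z \<in> U \<Longrightarrow> (ux has_derivative (\<lambda>h. uxx z * Re h + uxy z * Im h)) (at z)"
    and "\<And>z. z \<in> U \<Longrightarrow> (uy has_derivative (\<lambda>h. uyx z * Re h + uyy z * Im h)) (at z)"
    and "\<And>z. z \<in> U \<Longrightarrow> uxx z + uyy z = 0"
    and "continuous_on U uxx" "continuous_on U uxy" "continuous_on U uyx" "continuous_on U uyy"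
  shows "harmonic_on u U"
  using assms unfolding harmonic_on_def by blast

lemma harmonic_on_ln_cmod:
  assumes "open U" and "a \<notin> U"
  shows "harmonic_on (\<lambda>z. ln (cmod (z - a))) U"
proof -
  have ne: "z \<noteq> a" if "z \<in> U" for z
    using assms that by blast
  show ?thesis
    by (rule harmonic_onI[OF \<open>open U\<close> has_derivative_ln_cmod
          has_derivative_Re_div_cmod_squared has_derivative_Im_div_cmod_squared])
       (use ne in \<open>auto intro!: continuous_intros simp flip: add_divide_distrib\<close>)
qed

lemma harmonic_on_const: "open U \<Longrightarrow> harmonic_on (\<lambda>z. c) U"
  unfolding harmonic_on_def
  by (intro conjI exI[of _ "\<lambda>z. 0"]) auto

lemma harmonic_on_add:
  assumes "harmonic_on u U" and "harmonic_on v U"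
  shows "harmonic_on (\<lambda>z. u z + v z) U"
proof -
  from assms(1) obtain ux uy uxx uxy uyx uyy where U: "open U"
    and u: "\<And>z. z \<in> U \<Longrightarrow> (u has_derivative (\<lambda>h. ux z * Re h + uy z * Im h)) (at z)"
      "\<And>z. z \<in> U \<Longrightarrow> (ux has_derivative (\<lambda>h. uxx z * Re h + uxy z * Im h)) (at z)"
      "\<And>z. z \<in> U \<Longrightarrow> (uy has_derivative (\<lambda>h. uyx z * Re h + uyy z * Im h)) (at z)"
      "\<And>z. z \<in> U \<Longrightarrow> uxx z + uyy z = 0"
      "continuous_on U uxx" "continuous_on U uxy" "continuous_on U uyx" "continuous_on U uyy"
    unfolding harmonic_on_def by blast
  from assms(2) obtain vx vy vxx vxy vyx vyy where
       v: "\<And>z. z \<in> U \<Longrightarrow> (v has_derivative (\<lambda>h. vx z * Re h + vy z * Im h)) (at z)"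
      "\<And>z. z \<in> U \<Longrightarrow> (vx has_derivative (\<lambda>h. vxx z * Re h + vxy z * Im h)) (at z)"
      "\<And>z. z \<in> U \<Longrightarrow> (vy has_derivative (\<lambda>h. vyx z * Re h + vyy z * Im h)) (at z)"
      "\<And>z. z \<in> U \<Longrightarrow> vxx z + vyy z = 0"
      "continuous_on U vxx" "continuous_on U vxy" "continuous_on U vyx" "continuous_on U vyy"
    unfolding harmonic_on_def by blast
  show ?thesis
  proof (rule harmonic_onI[where ux="\<lambda>z. ux z + vx z" and uy="\<lambda>z. uy z + vy z" and
      uxx="\<lambda>z. uxx z + vxx z" and uxy="\<lambda>z. uxy z + vxy z" and
      uyx="\<lambda>z. uyx z + vyx z" and uyy="\<lambda>z. uyy z + vyy z"])
    fix z assume z: "z \<in> U"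
    show "((\<lambda>z. u z + v z) has_derivative (\<lambda>h. (ux z + vx z) * Re h + (uy z + vy z) * Im h)) (at z)"
      by (rule has_derivative_eq_rhs[OF has_derivative_add[OF u(1)[OF z] v(1)[OF z]]])
         (simp add: fun_eq_iff algebra_simps)
    show "((\<lambda>z. ux z + vx z) has_derivative (\<lambda>h. (uxx z + vxx z) * Re h + (uxy z + vxy z) * Im h)) (at z)"
      by (rule has_derivative_eq_rhs[OF has_derivative_add[OF u(2)[OF z] v(2)[OF z]]])
         (simp add: fun_eq_iff algebra_simps)
    show "((\<lambda>z. uy z + vy z) has_derivative (\<lambda>h. (uyx z + vyx z) * Re h + (uyy z + vyy z) * Im h)) (at z)"
      by (rule has_derivative_eq_rhs[OF has_derivative_add[OF u(3)[OF z] v(3)[OF z]]])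
         (simp add: fun_eq_iff algebra_simps)
    show "uxx z + vxx z + (uyy z + vyy z) = 0"
      using u(4)[OF z] v(4)[OF z] by simp
  qed (use U u v in \<open>auto intro!: continuous_intros\<close>)
qed

lemma harmonic_on_cmult:
  assumes "harmonic_on u U"
  shows "harmonic_on (\<lambda>z. c * u z) U"
proof -
  from assms obtain ux uy uxx uxy uyx uyy where U: "open U"
    and u: "\<And>z. z \<in> U \<Longrightarrow> (u has_derivative (\<lambda>h. ux z * Re h + uy z * Im h)) (at z)"
      "\<And>z. z \<in> U \<Longrightarrow> (ux has_derivative (\<lambda>h. uxx z * Re h + uxy z * Im h)) (at z)"
      "\<And>z. z \<in> U \<Longrightarrow> (uy has_derivative (\<lambda>h. uyx z * Re h + uyy z * Im h)) (at z)"
      "\<And>z. z \<in> U \<Longrightarrow> uxx z + uyy z = 0"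
      "continuous_on U uxx" "continuous_on U uxy" "continuous_on U uyx" "continuous_on U uyy"
    unfolding harmonic_on_def by blast
  show ?thesis
  proof (rule harmonic_onI[where ux="\<lambda>z. c * ux z" and uy="\<lambda>z. c * uy z" and
      uxx="\<lambda>z. c * uxx z" and uxy="\<lambda>z. c * uxy z" and
      uyx="\<lambda>z. c * uyx z" and uyy="\<lambda>z. c * uyy z"])
    fix z assume z: "z \<in> U"
    show "((\<lambda>z. c * u z) has_derivative (\<lambda>h. c * ux z * Re h + c * uy z * Im h)) (at z)"
      by (rule has_derivative_eq_rhs[OF has_derivative_mult_right[OF u(1)[OF z]]])
         (simp add: fun_eq_iff algebra_simps)
    show "((\<lambda>z. c * ux z) has_derivative (\<lambda>h. c * uxx z * Re h + c * uxy z * Im h)) (at z)"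
      by (rule has_derivative_eq_rhs[OF has_derivative_mult_right[OF u(2)[OF z]]])
         (simp add: fun_eq_iff algebra_simps)
    show "((\<lambda>z. c * uy z) has_derivative (\<lambda>h. c * uyx z * Re h + c * uyy z * Im h)) (at z)"
      by (rule has_derivative_eq_rhs[OF has_derivative_mult_right[OF u(3)[OF z]]])
         (simp add: fun_eq_iff algebra_simps)
    show "c * uxx z + c * uyy z = 0"
      using u(4)[OF z] by (simp flip: distrib_left)
  qed (use U u in \<open>auto intro!: continuous_intros\<close>)
qed

section \<open>The ends of the punctured plane\<close>

text \<open>
  A function that tends to a limit at both ends \<open>0\<close> and \<open>\<infinity>\<close> tends to it at the ideal
  boundary: what is left between a small and a large circle around \<open>0\<close> is compact.
\<close>
lemma at_ideal_boundary_punctured_plane_le: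
  "at_ideal_boundary (UNIV - {0}) \<le> sup (at 0) at_infinity"
proof (rule filter_leI)
  fix P :: "complex \<Rightarrow> bool"
  assume P: "eventually P (sup (at 0) at_infinity)"
  obtain r where r: "r > 0" "\<And>z. z \<noteq> 0 \<Longrightarrow> cmod z < r \<Longrightarrow> P z"
    using P by (auto simp: eventually_sup eventually_at)
  obtain R where R: "\<And>z. R \<le> cmod z \<Longrightarrow> P z"
    using P by (auto simp: eventually_sup eventually_at_infinity)
  define C where "C = cball (0::complex) R - ball 0 r"
  have "compact C"
    unfolding C_def by (intro compact_diff) auto
  moreover have "C \<subseteq> UNIV - {0}"
    using \<open>r > 0\<close> by (auto simp: C_def)
  ultimately have "openin (Alexandroff_compactification (top_of_set (UNIV - {0})))
      (insert None (Some ` (topspace (top_of_set (UNIV - {0})) - C)))"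
    unfolding openin_Alexandroff_compactification
    by (auto simp: compactin_subtopology intro!: closed_subset compact_imp_closed)
  moreover have "P z" if "z \<noteq> 0" "z \<notin> C" for z
    using r(2)[of z] R[of z] that by (auto simp: C_def)
  ultimately show "eventually P (at_ideal_boundary (UNIV - {0}))"
    unfolding at_ideal_boundary_def eventually_filtermap eventually_atin
    by (intro disjI2 exI[of _ "insert None (Some ` (topspace (top_of_set (UNIV - {0})) - C))"]) auto
qed

section \<open>The potentials\<close>

lemma Bfun_if_tendsto:
  fixes f :: "'a \<Rightarrow> 'b::real_normed_vector"
  assumes "(f \<longlongrightarrow> l) F"
  shows "Bfun f F"
proof (rule BfunI)
  show "\<forall>\<^sub>F x in F. norm (f x) \<le> norm l + 1"
    using order_tendstoD(2)[OF tendsto_norm[OF assms], of "norm l + 1"]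
    by (auto elim: eventually_mono)
qed

lemma filterlim_ln_cmod_at_infinity: "filterlim (\<lambda>z. ln (cmod z)) at_top at_infinity"
  by (rule filterlim_compose[OF ln_at_top filterlim_norm_at_top])

lemma filterlim_potential_at_0:
  fixes t :: real
  assumes "0 < t" and "q \<noteq> 0"
  shows "filterlim (\<lambda>p. ln (cmod (p - q)) + - t * ln (cmod p) + c) at_top (at 0)"
proof -
  have "filterlim (\<lambda>p::complex. cmod p) (at_right 0) (at 0)"
    by (auto simp: filterlim_at eventually_at_filter intro!: tendsto_eq_intros)
  then have "filterlim (\<lambda>p::complex. ln (cmod p)) at_bot (at 0)"
    by (rule filterlim_compose[OF ln_at_0])
  then have "filterlim (\<lambda>p::complex. t * ln (cmod p)) at_bot (at 0)"
    by (rule filterlim_tendsto_pos_mult_at_bot[OF tendsto_const \<open>0 < t\<close>])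
  then have "filterlim (\<lambda>p::complex. - t * ln (cmod p)) at_top (at 0)"
    by (simp add: filterlim_uminus_at_bot)
  moreover have "((\<lambda>p. ln (cmod (p - q)) + c) \<longlongrightarrow> ln (cmod (0 - q)) + c) (at 0)"
    using assms by (intro tendsto_intros) auto
  ultimately show ?thesis
    using filterlim_tendsto_add_at_top by (fastforce simp: algebra_simps)
qed

lemma filterlim_potential_at_infinity:
  fixes t :: real
  assumes "t < 1"
  shows "filterlim (\<lambda>p. ln (cmod (p - q)) + - t * ln (cmod p) + c) at_top at_infinity"
proof (rule filterlim_at_top_mono)
  show "filterlim (\<lambda>p::complex. (c - ln 2) + (1 - t) * ln (cmod p)) at_top at_infinity"
    using assms by (intro filterlim_tendsto_add_at_top[OF tendsto_const]
        filterlim_tendsto_pos_mult_at_top[OF tendsto_const] filterlim_ln_cmod_at_infinity) auto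
  show "\<forall>\<^sub>F p in at_infinity. (c - ln 2) + (1 - t) * ln (cmod p)
          \<le> ln (cmod (p - q)) + - t * ln (cmod p) + c"
    unfolding eventually_at_infinity
  proof (intro exI allI impI)
    fix p assume p: "2 * cmod q + 1 \<le> cmod p"
    \<comment> \<open>Far out, \<open>log|p - q|\<close> is at least \<open>log|p| - log 2\<close>.\<close>
    have "cmod p / 2 \<le> cmod (p - q)"
      using p norm_triangle_ineq2[of p q] by simp
    moreover have "0 < cmod p"
      using p norm_ge_zero[of q] by linarith
    ultimately have "ln (cmod p) - ln 2 \<le> ln (cmod (p - q))"
      by (smt (verit, best) ln_div ln_le_cancel_iff half_gt_zero)
    then show "(c - ln 2) + (1 - t) * ln (cmod p)
          \<le> ln (cmod (p - q)) + - t * ln (cmod p) + c"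
      by (simp add: algebra_simps)
  qed
qed

lemma Evans_Selberg_potential_punctured_plane:
  fixes t c :: real
  assumes "0 < t" and "t < 1" and "q \<noteq> 0"
  shows "Evans_Selberg_potential (UNIV - {0}) q
    (\<lambda>p. ln (cmod (p - q)) + - t * ln (cmod p) + c)"
  unfolding Evans_Selberg_potential_def
proof (intro conjI)
  show "open (UNIV - {0::complex})"
    by (intro open_Diff) auto
  show "connected (UNIV - {0::complex})"
    using connected_punctured_universe[of "0::complex"] by (simp add: Compl_eq_Diff_UNIV)
  show "q \<in> UNIV - {0}"
    using assms by simp
  have "open (UNIV - {0} - {q})"
    by (intro open_Diff) auto
  then show "harmonic_on (\<lambda>p. ln (cmod (p - q)) + - t * ln (cmod p) + c) (UNIV - {0} - {q})"
    using harmonic_on_ln_cmod[of "UNIV - {0} - {q}" 0]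
    by (intro harmonic_on_add harmonic_on_cmult harmonic_on_const harmonic_on_ln_cmod) auto
  have "((\<lambda>p. - t * ln (cmod p) + c) \<longlongrightarrow> - t * ln (cmod q) + c) (at q)"
    using assms by (intro tendsto_intros) auto
  then have "Bfun (\<lambda>p. - t * ln (cmod p) + c) (at q)"
    by (intro Bfun_if_tendsto)
  then show "Bfun (\<lambda>p. ln (cmod (p - q)) + - t * ln (cmod p) + c - ln (cmod (p - q))) (at q)"
    by simp
  show "filterlim (\<lambda>p. ln (cmod (p - q)) + - t * ln (cmod p) + c) at_top
      (at_ideal_boundary (UNIV - {0}))"
    using assms
    by (intro filterlim_mono[OF _ order_refl at_ideal_boundary_punctured_plane_le]
        filterlim_sup filterlim_potential_at_0 filterlim_potential_at_infinity)
qed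

theorem corollary1p2:
  fixes s :: real
  assumes "0 < s" and "s < 2"
  shows "fundamental_metric (UNIV - {0}) (\<lambda>z. cmod z powr (- s))"
proof -
  define E where "E q p = ln (cmod (p - q)) + - (s / 2) * ln (cmod p) + - (s / 2) * ln (cmod q)"
    for q p :: complex
  have "Evans_Selberg_potential (UNIV - {0}) q (E q)" if "q \<in> UNIV - {0}" for q
    unfolding E_def using assms that by (intro Evans_Selberg_potential_punctured_plane) auto
  moreover have "((\<lambda>q. E q p - ln (cmod (p - q))) \<longlongrightarrow> - s * ln (cmod p)) (at p within UNIV - {0})"
    if "p \<noteq> 0" for p
    unfolding E_def using that by (auto intro!: tendsto_eq_intros)
  moreover have "cmod p powr (- s) = exp (- s * ln (cmod p))" if "p \<noteq> 0" for p
    using that by (simp add: powr_def)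
  ultimately show ?thesis
    unfolding fundamental_metric_def associated_fundamental_metric_def by blast
qed

end
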